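(* Let $A$ be an abelian group. If $A$ (regarded as a generalized group under its group operation) is a slender generalized group, then $A$ is a slender group.
   Context: A generalized group is a semigroup $G$ such that (1) for each $x\in G$ there is a unique element $e(x)\in G$ with $e(x)x=xe(x)=x$, and (2) for each $x\in G$ there is $y\in G$ with $xy=yx=e(x)$. A homomorphism of generalized groups is a map $f:G\to H$ with $f(ab)=f(a)f(b)$ for all $a,b\in G$. Every group is a generalized group, with $e(x)$ the identity element for all $x$. Let $\mathbb{N}=\{1,2,3,\ldots\}$. For $n\in\mathbb{N}$, $i_n\in\prod_{\mathbb{N}}\mathbb{Z}$ denotes the sequence with $i_n(n)=1$ and $i_n(k)=0$ for $k\neq n$. With its usual coordinatewise addition, $\prod_{\mathbb{N}}\mathbb{Z}$ is an abelian group. An abelian group $A$ is a slender group if for every group homomorphism $h:\prod_{\mathbb{N}}\mathbb{Z}\to A$ the set $\{n\in\mathbb{N}\mid h(i_n)\neq 0\}$ is finite. $\prod_{\mathbb{N}}^{g}\mathbb{Z}$ denotes the generalized group with underlying set $\prod_{\mathbb{N}}\mathbb{Z}$ and operation $*$ given by $(x*y)_k=x_k$ if $k\equiv 1 \pmod 3$, $(x*y)_k=y_k$ if $k\equiv 2\pmod 3$, and $(x*y)_k=x_k+y_k$ if $k\equiv 0\pmod 3$. A generalized group $G$ is a slender generalized group if for every homomorphism of generalized groups $h:\prod_{\mathbb{N}}^{g}\mathbb{Z}\to G$ the set $\{n\in\mathbb{N}\mid h(i_n)\neq e(h(i_n))\}$ is finite. *)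

theory Defs
  imports "HOL-Algebra.Product_Groups" "HOL-Algebra.Elementary_Groups"
begin

text \<open>
  Generalized groups are carried by the \<open>monoid\<close> record, whose field \<open>\<one>\<close> is never used here:
  in this way a group is literally regarded as a generalized group, and homomorphisms of
  generalized groups are the elements of \<^const>\<open>hom\<close>.
\<close>

definition local_one :: "('a, 'b) monoid_scheme \<Rightarrow> 'a \<Rightarrow> 'a" where
  "local_one G x = (THE e. e \<in> carrier G \<and> e \<otimes>\<^bsub>G\<^esub> x = x \<and> x \<otimes>\<^bsub>G\<^esub> e = x)"

locale generalized_group =
  fixes G (structure)
  assumes m_closed: "\<lbrakk>x \<in> carrier G; y \<in> carrier G\<rbrakk> \<Longrightarrow> x \<otimes> y \<in> carrier G"
    and m_assoc: "\<lbrakk>x \<in> carrier G; y \<in> carrier G; z \<in> carrier G\<rbrakk>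
      \<Longrightarrow> (x \<otimes> y) \<otimes> z = x \<otimes> (y \<otimes> z)"
    and ex1_local_one: "x \<in> carrier G \<Longrightarrow> \<exists>!e. e \<in> carrier G \<and> e \<otimes> x = x \<and> x \<otimes> e = x"
    and ex_local_inv: "x \<in> carrier G \<Longrightarrow>
      \<exists>y\<in>carrier G. x \<otimes> y = local_one G x \<and> y \<otimes> x = local_one G x"

text \<open>The index set is \<open>{1..}\<close>; sequences are extensional, i.e. \<^const>\<open>undefined\<close> at index \<open>0\<close>.\<close>

definition int_seqs :: "(nat \<Rightarrow> int) monoid" where
  "int_seqs = product_group {1..} (\<lambda>_. integer_group)"

definition unit_seq :: "nat \<Rightarrow> nat \<Rightarrow> int" where
  "unit_seq n = (\<lambda>k\<in>{1..}. if k = n then 1 else 0)"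

definition gen_int_seqs :: "(nat \<Rightarrow> int) monoid" where
  "gen_int_seqs = \<lparr>
     carrier = carrier int_seqs,
     monoid.mult = (\<lambda>x y. \<lambda>k\<in>{1..}.
       if k mod 3 = 1 then x k else if k mod 3 = 2 then y k else x k + y k),
     one = undefined\<rparr>"

definition slender_group :: "('a, 'b) monoid_scheme \<Rightarrow> bool" where
  "slender_group A \<longleftrightarrow> comm_group A \<and>
     (\<forall>h\<in>hom int_seqs A. finite {n\<in>{1..}. h (unit_seq n) \<noteq> \<one>\<^bsub>A\<^esub>})"

definition slender_generalized_group :: "('a, 'b) monoid_scheme \<Rightarrow> bool" where
  "slender_generalized_group G \<longleftrightarrow> generalized_group G \<and>
     (\<forall>h\<in>hom gen_int_seqs G.
        finite {n\<in>{1..}. h (unit_seq n) \<noteq> local_one G (h (unit_seq n))})"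

lemma (in generalized_group) local_one:
  assumes "x \<in> carrier G"
  shows "local_one G x \<in> carrier G" "local_one G x \<otimes> x = x" "x \<otimes> local_one G x = x"
  using theI'[OF ex1_local_one[OF assms]] by (simp_all add: local_one_def)

lemma (in group) local_one_eq_one:
  assumes "x \<in> carrier G"
  shows "local_one G x = \<one>"
  unfolding local_one_def using assms by (intro the_equality) auto

lemma (in group) generalized_group: "generalized_group G"
proof
  fix x assume x: "x \<in> carrier G"
  show "\<exists>!e. e \<in> carrier G \<and> e \<otimes> x = x \<and> x \<otimes> e = x"
    using x by (intro ex1I[of _ \<one>]) auto
  show "\<exists>y\<in>carrier G. x \<otimes> y = local_one G x \<and> y \<otimes> x = local_one G x"
    using x by (intro bexI[of _ "inv x"]) (auto simp: local_one_eq_one)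
qed (auto simp: m_assoc)

lemma comm_group_int_seqs: "comm_group int_seqs"
proof (rule group.group_comm_groupI)
  show "group int_seqs"
    by (simp add: int_seqs_def)
qed (auto simp: int_seqs_def add.commute)

lemma unit_seq_carrier: "unit_seq n \<in> carrier int_seqs"
  by (auto simp: unit_seq_def int_seqs_def)

lemma generalized_group_gen_int_seqs: "generalized_group gen_int_seqs"
proof
  fix x y z
  assume "x \<in> carrier gen_int_seqs" "y \<in> carrier gen_int_seqs"
  then show "x \<otimes>\<^bsub>gen_int_seqs\<^esub> y \<in> carrier gen_int_seqs"
    by (auto simp: gen_int_seqs_def int_seqs_def)
  show "(x \<otimes>\<^bsub>gen_int_seqs\<^esub> y) \<otimes>\<^bsub>gen_int_seqs\<^esub> z = x \<otimes>\<^bsub>gen_int_seqs\<^esub> (y \<otimes>\<^bsub>gen_int_seqs\<^esub> z)"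
    by (auto simp: gen_int_seqs_def)
next
  fix x
  assume x: "x \<in> carrier gen_int_seqs"
  define e where "e = (\<lambda>k\<in>{1..}. if k mod 3 = 0 then 0 else x k)"
  define y where "y = (\<lambda>k\<in>{1..}. if k mod 3 = 0 then - x k else x k)"
  have xe: "x k = undefined" if "\<not> 1 \<le> k" for k
    using x that by (auto simp: gen_int_seqs_def int_seqs_def PiE_def extensional_def)
  have m: "k mod 3 = 0 \<or> k mod 3 = 1 \<or> k mod 3 = 2" for k :: nat by linarith
  have e: "e \<in> carrier gen_int_seqs" "e \<otimes>\<^bsub>gen_int_seqs\<^esub> x = x" "x \<otimes>\<^bsub>gen_int_seqs\<^esub> e = x"
    and y: "y \<in> carrier gen_int_seqs" "x \<otimes>\<^bsub>gen_int_seqs\<^esub> y = e" "y \<otimes>\<^bsub>gen_int_seqs\<^esub> x = e"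
    using xe m by (auto simp: gen_int_seqs_def int_seqs_def e_def y_def fun_eq_iff)
  show "\<exists>!e. e \<in> carrier gen_int_seqs \<and> e \<otimes>\<^bsub>gen_int_seqs\<^esub> x = x \<and> x \<otimes>\<^bsub>gen_int_seqs\<^esub> e = x"
  proof (rule ex1I[of _ e])
    fix e' assume e': "e' \<in> carrier gen_int_seqs \<and> e' \<otimes>\<^bsub>gen_int_seqs\<^esub> x = x \<and> x \<otimes>\<^bsub>gen_int_seqs\<^esub> e' = x"
    show "e' = e"
    proof
      fix k
      have "(e' \<otimes>\<^bsub>gen_int_seqs\<^esub> x) k = x k" "(x \<otimes>\<^bsub>gen_int_seqs\<^esub> e') k = x k"
        using e' by simp_all
      moreover have "e' k = undefined" if "\<not> 1 \<le> k"
        using e' that by (auto simp: gen_int_seqs_def int_seqs_def PiE_def extensional_def)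
      ultimately show "e' k = e k"
        using m[of k] by (cases "1 \<le> k") (auto simp: gen_int_seqs_def e_def)
    qed
  qed (use e in auto)
  then have "local_one gen_int_seqs x = e"
    unfolding local_one_def using e by (intro the1_equality) auto
  with y show "\<exists>y\<in>carrier gen_int_seqs. x \<otimes>\<^bsub>gen_int_seqs\<^esub> y = local_one gen_int_seqs x \<and>
      y \<otimes>\<^bsub>gen_int_seqs\<^esub> x = local_one gen_int_seqs x"
    by auto
qed

end

theory Submission
  imports Defs
begin

text \<open>
  In the generalized group of integer sequences the coordinates divisible by \<open>3\<close> are added as
  in the ordinary product, and infinitely many of them are available. Reading off exactly these
  coordinates is therefore a homomorphism to the ordinary product group
  (\<open>subseq3_hom\<close>), and it sends the unit sequence at \<open>3 * n\<close> to the one at \<open>n\<close>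
  (\<open>subseq3_unit_seq\<close>). Composing it with a group homomorphism \<open>h\<close> to \<open>A\<close> gives a homomorphism
  of generalized groups. Since every local identity of the group \<open>A\<close> is its identity, each index
  \<open>n\<close> that \<open>h\<close> does not kill yields the index \<open>3 * n\<close> that the composite does not kill. There
  are finitely many of the latter, and \<open>n \<mapsto> 3 * n\<close> is injective.
\<close>

definition subseq3 :: "(nat \<Rightarrow> int) \<Rightarrow> nat \<Rightarrow> int" where
  "subseq3 x = (\<lambda>n\<in>{1..}. x (3 * n))"

lemma subseq3_hom: "subseq3 \<in> hom gen_int_seqs int_seqs"
  by (rule homI) (auto simp: subseq3_def gen_int_seqs_def int_seqs_def fun_eq_iff)

lemma subseq3_unit_seq: "subseq3 (unit_seq (3 * n)) = unit_seq n"
  by (auto simp: subseq3_def unit_seq_def fun_eq_iff)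

theorem theorem1p11:
  fixes A :: "('a, 'b) monoid_scheme"
  assumes "comm_group A"
    and "slender_generalized_group A"
  shows "slender_group A"
  unfolding slender_group_def
proof (intro conjI ballI)
  show "comm_group A" by fact
  then interpret comm_group A .
  fix h assume h: "h \<in> hom int_seqs A"
  define g where "g = h \<circ> subseq3"
  let ?N = "{n\<in>{1..}. h (unit_seq n) \<noteq> \<one>\<^bsub>A\<^esub>}"
  let ?M = "{m\<in>{1..}. g (unit_seq m) \<noteq> local_one A (g (unit_seq m))}"
  have "g \<in> hom gen_int_seqs A"
    unfolding g_def using subseq3_hom h by (rule Group.hom_compose)
  with assms(2) have "finite ?M"
    by (simp add: slender_generalized_group_def)
  moreover have "(*) 3 ` ?N \<subseteq> ?M"
    using hom_in_carrier[OF h unit_seq_carrier]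
    by (auto simp: g_def subseq3_unit_seq local_one_eq_one)
  ultimately have "finite ((*) 3 ` ?N)"
    by (rule finite_subset[rotated])
  then show "finite ?N"
    by (rule finite_imageD) (simp add: inj_on_def)
qed

end
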